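(* Let $h,g,f:[0,\infty)\to\mathbb{R}$ be functions with $h(s)\neq 0$ for all $s$, and for real $0\le s\le t$ let $E_1^{[s,t]}$ be the three-dimensional real evolution algebra whose matrix of structural constants is $$\mathcal M_{1}^{[s,t]}=\frac{h(t)}{2}\begin{pmatrix} \frac{1}{h(s)}+f(s)& \frac{1}{h(s)}+f(s)& \frac{1}{h(s)}+f(s)\\ \frac{1}{h(s)}-g(s)& \frac{1}{h(s)}-g(s)& \frac{1}{h(s)}-g(s)\\ g(s)-f(s)& g(s)-f(s)& g(s)-f(s)\end{pmatrix}.$$ For given values $(s,t)$ of time, $0\le s\le t$, the algebra $E_1^{[s,t]}$ is isomorphic to: (a) $E_4$ if one of the following holds: 1) $g(s)=f(s)=\frac1{h(s)}$; 2) $g(s)=f(s)=-\frac1{h(s)}$; 3) $g(s)=-f(s)=\frac1{h(s)}$. (b) $E_5$ if one of the following holds: 1) $f(s)=-\frac1{h(s)}$ and $f^2(s)>g^2(s)$; 2) $g(s)=\frac1{h(s)}$ and $g^2(s)>f^2(s)$; 3) $g(s)=f(s)$ and $\frac1{h^2(s)}>f^2(s)$. (c) $E_6$ if one of the following holds: 1) $f(s)=-\frac1{h(s)}$ and $f^2(s)<g^2(s)$; 2) $g(s)=\frac1{h(s)}$ and $g^2(s)<f^2(s)$; 3) $g(s)=f(s)$ and $\frac1{h^2(s)}<f^2(s)$. (d) $E_7$ if the following all hold: $\left(\frac{1}{h(s)}+f(s)\right)\left(\frac{1}{h(s)}-g(s)\right)(g(s)-f(s))\neq 0$, $(g(s)-f(s))\left(\frac{2}{h(s)}+f(s)-g(s)\right)>0$,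 $\frac{2}{h(s)}\left(\frac{1}{h(s)}+f(s)\right)\left(\frac{1}{h(s)}-g(s)\right)\left(\frac{2}{h(s)}+f(s)-g(s)\right)>0$. (e) $E_8$ if one of the following holds: 1) $\left(\frac{1}{h(s)}+f(s)\right)\left(\frac{1}{h(s)}-g(s)\right)(g(s)-f(s))\neq 0$, $(g(s)-f(s))\left(\frac{2}{h(s)}+f(s)-g(s)\right)<0$ and $\frac{2}{h(s)}\left(\frac{1}{h(s)}+f(s)\right)\left(\frac{1}{h(s)}-g(s)\right)\left(\frac{2}{h(s)}+f(s)-g(s)\right)>0$; 2) $\left(\frac{1}{h(s)}+f(s)\right)\left(\frac{1}{h(s)}-g(s)\right)(g(s)-f(s))\neq 0$, $(g(s)-f(s))\left(\frac{2}{h(s)}+f(s)-g(s)\right)>0$ and $\frac{2}{h(s)}\left(\frac{1}{h(s)}+f(s)\right)\left(\frac{1}{h(s)}-g(s)\right)\left(\frac{2}{h(s)}+f(s)-g(s)\right)<0$; 3) $\left(\frac{1}{h(s)}+f(s)\right)\left(\frac{1}{h(s)}-g(s)\right)(g(s)-f(s))\neq 0$ and $\frac{2}{h(s)}+f(s)-g(s)=0$. (f) $E_9$ if the following all hold: $\left(\frac{1}{h(s)}+f(s)\right)\left(\frac{1}{h(s)}-g(s)\right)(g(s)-f(s))\neq 0$, $(g(s)-f(s))\left(\frac{2}{h(s)}+f(s)-g(s)\right)<0$, $\frac{2}{h(s)}\left(\frac{1}{h(s)}+f(s)\right)\left(\frac{1}{h(s)}-g(s)\right)\left(\frac{2}{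h(s)}+f(s)-g(s)\right)<0$.
   Context: A three-dimensional real evolution algebra with matrix of structural constants $(a_{ij})_{i,j=1}^{3}$ is the real (commutative) algebra with basis $e_1,e_2,e_3$ and multiplication $e_ie_i=\sum_{j=1}^3 a_{ij}e_j$, $e_ie_j=0$ for $i\neq j$. Isomorphism means isomorphism of algebras over $\mathbb{R}$. The algebras $E_4,\dots,E_9$ are the three-dimensional real evolution algebras with the following matrices of structural constants: $$E_4:\begin{pmatrix}1&0&0\\0&0&0\\0&0&0\end{pmatrix},\quad E_5:\begin{pmatrix}1&0&0\\0&0&0\\1&0&0\end{pmatrix},\quad E_6:\begin{pmatrix}1&0&0\\0&0&0\\-1&0&0\end{pmatrix},$$ $$E_7:\begin{pmatrix}1&0&0\\1&0&0\\1&0&0\end{pmatrix},\quad E_8:\begin{pmatrix}1&0&0\\1&0&0\\-1&0&0\end{pmatrix},\quad E_9:\begin{pmatrix}1&0&0\\-1&0&0\\-1&0&0\end{pmatrix}.$$ *)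

theory Defs
  imports "HOL-Analysis.Analysis"
begin

text \<open>A (not necessarily associative) real algebra on a real vector space is given by its product.\<close>

definition algebra_iso :: "('a::real_vector \<Rightarrow> 'a \<Rightarrow> 'a) \<Rightarrow> ('b::real_vector \<Rightarrow> 'b \<Rightarrow> 'b) \<Rightarrow> bool" where
  "algebra_iso p q \<longleftrightarrow> (\<exists>\<phi>. linear \<phi> \<and> bij \<phi> \<and> (\<forall>x y. \<phi> (p x y) = q (\<phi> x) (\<phi> y)))"

text \<open>The basis vectors are \<open>axis i 1\<close>; row \<open>i\<close> of the matrix holds the coordinates of the square
  of the \<open>i\<close>-th one. The lemma \<open>evol_mult_unique\<close> below shows that this product is the
  bilinear one determined by the multiplication table of the basis.\<close>

definition evol_mult :: "real^'n^'n \<Rightarrow> real^'n \<Rightarrow> real^'n \<Rightarrow> real^'n" where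
  "evol_mult A x y = (\<Sum>i\<in>UNIV. (x $ i * y $ i) *\<^sub>R (\<Sum>j\<in>UNIV. A $ i $ j *\<^sub>R axis j 1))"

definition evol_iso :: "real^'n^'n \<Rightarrow> real^'m^'m \<Rightarrow> bool" where
  "evol_iso A B \<longleftrightarrow> algebra_iso (evol_mult A) (evol_mult B)"

lemma evol_mult_commute: "evol_mult A x y = evol_mult A y x"
  by (simp add: evol_mult_def mult.commute)

lemma bilinear_evol_mult: "bilinear (evol_mult A)"
  unfolding bilinear_def
  by (auto intro!: linearI
      simp: evol_mult_def distrib_left distrib_right scaleR_add_left sum.distrib
        scaleR_right.sum mult.assoc mult.left_commute)

lemma evol_mult_axis_same:
  "evol_mult A (axis i 1) (axis i 1) = (\<Sum>j\<in>UNIV. A $ i $ j *\<^sub>R axis j 1)"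
proof -
  have "evol_mult A (axis i 1) (axis i 1)
      = (\<Sum>k\<in>UNIV. if k = i then (\<Sum>j\<in>UNIV. A $ i $ j *\<^sub>R axis j 1) else 0)"
    unfolding evol_mult_def by (rule sum.cong) (auto simp: axis_def)
  then show ?thesis by simp
qed

lemma evol_mult_axis_diff:
  "i \<noteq> j \<Longrightarrow> evol_mult A (axis i 1) (axis j 1) = 0"
  unfolding evol_mult_def by (rule sum.neutral) (auto simp: axis_def)

lemma evol_mult_unique:
  fixes A :: "real^'n^'n" and p :: "real^'n \<Rightarrow> real^'n \<Rightarrow> real^'n"
  assumes "bilinear p"
    and "\<And>i. p (axis i 1) (axis i 1) = (\<Sum>j\<in>UNIV. A $ i $ j *\<^sub>R axis j 1)"
    and "\<And>i j. i \<noteq> j \<Longrightarrow> p (axis i 1) (axis j 1) = 0"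
  shows "p = evol_mult A"
proof -
  have "p x y = evol_mult A x y" if "x \<in> Basis" "y \<in> Basis" for x y
    using that assms(2,3) evol_mult_axis_same[of A] evol_mult_axis_diff[of _ _ A]
    by (auto simp: Basis_vec_def) (metis)
  then show ?thesis
    by (intro bilinear_eq_stdbasis[OF assms(1) bilinear_evol_mult]) auto
qed

definition E4 :: "real^3^3" where
  "E4 = vector [vector [1, 0, 0], vector [0, 0, 0], vector [0, 0, 0]]"

definition E5 :: "real^3^3" where
  "E5 = vector [vector [1, 0, 0], vector [0, 0, 0], vector [1, 0, 0]]"

definition E6 :: "real^3^3" where
  "E6 = vector [vector [1, 0, 0], vector [0, 0, 0], vector [- 1, 0, 0]]"

definition E7 :: "real^3^3" where
  "E7 = vector [vector [1, 0, 0], vector [1, 0, 0], vector [1, 0, 0]]"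

definition E8 :: "real^3^3" where
  "E8 = vector [vector [1, 0, 0], vector [1, 0, 0], vector [- 1, 0, 0]]"

definition E9 :: "real^3^3" where
  "E9 = vector [vector [1, 0, 0], vector [- 1, 0, 0], vector [- 1, 0, 0]]"

definition M1 :: "(real \<Rightarrow> real) \<Rightarrow> (real \<Rightarrow> real) \<Rightarrow> (real \<Rightarrow> real) \<Rightarrow> real \<Rightarrow> real \<Rightarrow> real^3^3" where
  "M1 h g f s t = (h t / 2) *\<^sub>R vector
     [vector [1 / h s + f s, 1 / h s + f s, 1 / h s + f s],
      vector [1 / h s - g s, 1 / h s - g s, 1 / h s - g s],
      vector [g s - f s, g s - f s, g s - f s]]"

end

theory Submission
  imports Defs
begin

text \<open>All rows of the matrix are multiples of \<open>v = (1,1,1)\<close>, so the product is \<open>x y = Q(x,y) v\<close>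
  with \<open>Q = diag(a,b,c)\<close> and \<open>\<sigma> = Q(v,v) = a + b + c = h(t)/h(s) \<noteq> 0\<close>. Thus \<open>v/\<sigma>\<close> is an
  idempotent, and the isomorphism class is determined by the signs of \<open>\<sigma>Q\<close> on an orthogonal
  basis of the \<open>Q\<close>-complement of \<open>v\<close>. If \<open>p = a + b \<noteq> 0\<close>, such a basis consists of
  \<open>(b,-a,0)\<close> and \<open>(c,c,-p)\<close>, on which \<open>\<sigma>Q\<close> takes the values \<open>\<sigma>abp\<close> and \<open>\<sigma>\<^sup>2cp\<close>;
  if \<open>p = 0\<close> and \<open>a \<noteq> 0\<close>, then \<open>Q\<close> is indefinite on the complement, and if \<open>a = b = 0\<close>, one
  permutes the natural basis.\<close>

section \<open>Isomorphism of algebras as a symmetric and transitive relation\<close>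

lemma algebra_iso_sym:
  assumes "algebra_iso p q"
  shows "algebra_iso q p"
proof -
  obtain \<phi> where \<phi>: "linear \<phi>" "bij \<phi>" "\<And>x y. \<phi> (p x y) = q (\<phi> x) (\<phi> y)"
    using assms unfolding algebra_iso_def by blast
  have surj: "\<phi> (inv \<phi> x) = x" for x
    using \<phi>(2) by (simp add: bij_is_surj surj_f_inv_f)
  have inj: "inv \<phi> (\<phi> x) = x" for x
    using \<phi>(2) by (simp add: bij_is_inj)
  have "linear (inv \<phi>)"
  proof (rule linearI)
    show "inv \<phi> (x + y) = inv \<phi> x + inv \<phi> y" for x y
      by (metis surj inj linear_add[OF \<phi>(1)])
    show "inv \<phi> (r *\<^sub>R x) = r *\<^sub>R inv \<phi> x" for r x
      by (metis surj inj linear_scale[OF \<phi>(1)])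
  qed
  moreover have "inv \<phi> (q x y) = p (inv \<phi> x) (inv \<phi> y)" for x y
    by (metis surj inj \<phi>(3))
  ultimately show ?thesis
    unfolding algebra_iso_def using bij_imp_bij_inv[OF \<phi>(2)] by blast
qed

lemma algebra_iso_trans:
  assumes "algebra_iso p q" "algebra_iso q r"
  shows "algebra_iso p r"
proof -
  obtain \<phi> where \<phi>: "linear \<phi>" "bij \<phi>" "\<And>x y. \<phi> (p x y) = q (\<phi> x) (\<phi> y)"
    using assms(1) unfolding algebra_iso_def by blast
  obtain \<psi> where \<psi>: "linear \<psi>" "bij \<psi>" "\<And>x y. \<psi> (q x y) = r (\<psi> x) (\<psi> y)"
    using assms(2) unfolding algebra_iso_def by blast
  have "linear (\<psi> \<circ> \<phi>)" "bij (\<psi> \<circ> \<phi>)"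
    using \<phi> \<psi> by (auto intro: linear_compose bij_comp)
  moreover have "(\<psi> \<circ> \<phi>) (p x y) = r ((\<psi> \<circ> \<phi>) x) ((\<psi> \<circ> \<phi>) y)" for x y
    using \<phi>(3) \<psi>(3) by simp
  ultimately show ?thesis
    unfolding algebra_iso_def by blast
qed

lemma evol_iso_sym: "evol_iso A B \<Longrightarrow> evol_iso B A"
  unfolding evol_iso_def by (rule algebra_iso_sym)

lemma evol_iso_trans [trans]: "evol_iso A B \<Longrightarrow> evol_iso B C \<Longrightarrow> evol_iso A C"
  unfolding evol_iso_def by (rule algebra_iso_trans)

section \<open>Isomorphisms obtained by changing the natural basis\<close>

lemma evol_mult_nth: "evol_mult A x y $ j = (\<Sum>i\<in>UNIV. x $ i * y $ i * A $ i $ j)"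
  by (simp add: evol_mult_def axis_def if_distrib[where f="\<lambda>z. _ * z"] cong: if_cong)

lemma evol_mult_axis_row: "evol_mult A (axis i 1) (axis i 1) = A $ i"
  unfolding evol_mult_axis_same
  by (simp add: vec_eq_iff axis_def if_distrib[where f="\<lambda>z. _ * z"] cong: if_cong)

text \<open>The columns of \<open>P\<close> form a natural basis of the algebra of \<open>A\<close>
  whose multiplication table is \<open>B\<close>. Multiplication by \<open>P\<close> therefore
  carries the product of \<open>B\<close> to that of \<open>A\<close>, which by bilinearity has to
  be checked on basis vectors only; symmetry then reverses the direction.\<close>

lemma evol_iso_change_of_basis:
  fixes A B P :: "real^'n^'n"
  assumes "invertible P"
    and same: "\<And>i. evol_mult A (column i P) (column i P) = P *v (B $ i)"
    and diff: "\<And>i j. i \<noteq> j \<Longrightarrow> evol_mult A (column i P) (column j P) = 0"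
  shows "evol_iso A B"
proof -
  have lin: "linear ((*v) P)"
    by (rule matrix_vector_mul_linear)
  have bij: "bij ((*v) P)"
    using \<open>invertible P\<close> by (simp add: invertible_eq_bij)
  have "bilinear (\<lambda>x y. P *v evol_mult B x y)"
    using bilinear_evol_mult[of B] lin
    unfolding bilinear_def by (auto intro: linear_compose[unfolded o_def])
  moreover have "bilinear (\<lambda>x y. evol_mult A (P *v x) (P *v y))"
    using bilinear_evol_mult[of A] lin
    unfolding bilinear_def by (auto intro: linear_compose[OF lin, unfolded o_def])
  moreover have "P *v evol_mult B x y = evol_mult A (P *v x) (P *v y)"
    if xB: "x \<in> Basis" and yB: "y \<in> Basis" for x y
  proof -
    obtain i where x: "x = axis i 1"
      using xB by (auto simp: Basis_vec_def)
    obtain j where y: "y = axis j 1"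
      using yB by (auto simp: Basis_vec_def)
    show ?thesis
      by (cases "i = j")
        (simp_all add: x y matrix_vector_mult_basis evol_mult_axis_row evol_mult_axis_diff same diff)
  qed
  ultimately have "(\<lambda>x y. P *v evol_mult B x y) = (\<lambda>x y. evol_mult A (P *v x) (P *v y))"
    by (intro ext bilinear_eq_stdbasis[of "\<lambda>x y. P *v evol_mult B x y"]) auto
  then have "evol_iso B A"
    unfolding evol_iso_def algebra_iso_def using lin bij by metis
  then show ?thesis
    by (rule evol_iso_sym)
qed

lemma evol_iso_permute:
  fixes A :: "real^'n^'n"
  assumes "bij \<pi>"
  shows "evol_iso A (\<chi> i j. A $ \<pi> i $ \<pi> j)"
proof -
  define \<phi> where "\<phi> = (\<lambda>x::real^'n. \<chi> i. x $ \<pi> i)"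
  have "linear \<phi>"
    by (rule linearI) (auto simp: \<phi>_def vec_eq_iff)
  moreover have "bij \<phi>"
    using assms
    by (intro bij_betw_byWitness[where f'="\<lambda>x. \<chi> i. x $ inv \<pi> i"])
      (auto simp: \<phi>_def vec_eq_iff bij_is_inj bij_is_surj surj_f_inv_f)
  moreover have "\<phi> (evol_mult A x y) = evol_mult (\<chi> i j. A $ \<pi> i $ \<pi> j) (\<phi> x) (\<phi> y)" for x y
    by (auto simp: vec_eq_iff \<phi>_def evol_mult_nth
        intro!: sum.reindex_bij_betw[OF assms, symmetric, of "\<lambda>i. x $ i * y $ i * A $ i $ _"])
  ultimately show ?thesis
    unfolding evol_iso_def algebra_iso_def by blast
qed

section \<open>Normal forms of algebras with constant rows\<close>

definition const_rows :: "real \<Rightarrow> real \<Rightarrow> real \<Rightarrow> real^3^3" where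
  "const_rows a b c = vector [vector [a, a, a], vector [b, b, b], vector [c, c, c]]"

text \<open>The common shape of the six target algebras, with \<open>d\<close> and \<open>e\<close>
  among -1, 0, 1.\<close>

definition first_column :: "real \<Rightarrow> real \<Rightarrow> real^3^3" where
  "first_column d e = vector [vector [1, 0, 0], vector [d, 0, 0], vector [e, 0, 0]]"

text \<open>Serves the case where the first two rows vanish: a rotation moves the nonzero row so
  that the sum of the first two entries is nonzero.\<close>

lemma evol_iso_const_rows_rotate: "evol_iso (const_rows a b c) (const_rows b c a)"
proof -
  define \<pi> :: "3 \<Rightarrow> 3" where "\<pi> = (\<lambda>i. if i = 1 then 2 else if i = 2 then 3 else 1)"
  have "\<pi> (\<pi> (\<pi> i)) = i" for i
    using exhaust_3[of i] by (auto simp: \<pi>_def)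
  then have "bij \<pi>"
    by (intro o_bij[of "\<pi> \<circ> \<pi>"]) (auto simp: fun_eq_iff)
  moreover have "const_rows b c a = (\<chi> i j. const_rows a b c $ \<pi> i $ \<pi> j)"
    by (simp add: vec_eq_iff forall_3 const_rows_def \<pi>_def)
  ultimately show ?thesis
    using evol_iso_permute by metis
qed

text \<open>The targets fix an order of the two signs, while diagonalisation may produce them in the
  other order.\<close>

lemma evol_iso_first_column_swap: "evol_iso (first_column d e) (first_column e d)"
proof -
  define \<pi> :: "3 \<Rightarrow> 3" where "\<pi> = (\<lambda>i. if i = 2 then 3 else if i = 3 then 2 else i)"
  have "bij \<pi>"
    by (rule o_bij[of \<pi>]) (auto simp: \<pi>_def fun_eq_iff)
  moreover have "first_column e d = (\<chi> i j. first_column d e $ \<pi> i $ \<pi> j)"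
    by (simp add: vec_eq_iff forall_3 first_column_def \<pi>_def)
  ultimately show ?thesis
    using evol_iso_permute by metis
qed

text \<open>Scaling a basis vector by \<open>r\<close> multiplies its square by the square of
  \<open>r\<close>, so only the sign of the coefficient \<open>q\<close> survives
  normalisation.\<close>

lemma square_rescale_sgn: "\<exists>r::real. r \<noteq> 0 \<and> r\<^sup>2 * q = sgn q"
proof (cases "q = 0")
  case False
  then have "(1 / sqrt \<bar>q\<bar>)\<^sup>2 * q = sgn q"
    by (simp add: power_divide sgn_div_norm field_simps abs_if)
  with False show ?thesis
    by (intro exI[of _ "1 / sqrt \<bar>q\<bar>"]) auto
qed auto

lemma sgn_mult_pos_left: "0 < (k::real) \<Longrightarrow> sgn (k * x) = sgn x"
  by (simp add: sgn_mult)

lemma evol_iso_const_rows: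
  assumes p: "a + b \<noteq> 0" and \<sigma>: "a + b + c \<noteq> 0"
  shows "evol_iso (const_rows a b c)
    (first_column (sgn ((a + b + c) * a * b * (a + b))) (sgn (c * (a + b))))"
proof -
  define s where "s = a + b + c"
  have s0: "s \<noteq> 0" and c: "c = s - a - b"
    using \<sigma> by (auto simp: s_def)
  obtain r where r: "r \<noteq> 0" "r\<^sup>2 * (s * a * b * (a + b)) = sgn (s * a * b * (a + b))"
    using square_rescale_sgn by blast
  obtain q where q: "q \<noteq> 0" "q\<^sup>2 * (c * (a + b)) = sgn (c * (a + b))"
    using square_rescale_sgn by blast
  \<comment> \<open>The columns are the idempotent \<open>v/s\<close> and multiples of the two
    orthogonal vectors, by \<open>r\<close> and \<open>q/s\<close>. The factor \<open>1/s\<close> in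
    the third column reduces the value on \<open>(c,c,-p)\<close> to
    \<open>c * (a + b)\<close>.\<close>
  define P :: "real^3^3" where
    "P = vector [vector [1 / s, r * b, q / s * c],
                 vector [1 / s, - (r * a), q / s * c],
                 vector [1 / s, 0, - (q / s * (a + b))]]"
  have "det P = r * q * (a + b) / s"
    using s0 by (simp add: P_def det_3 c field_simps)
  then have "invertible P"
    using p s0 r(1) q(1) by (simp add: invertible_det_nz)
  then have "evol_iso (const_rows a b c)
      (first_column (sgn (s * a * b * (a + b))) (sgn (c * (a + b))))"
  proof (rule evol_iso_change_of_basis)
    show "evol_mult (const_rows a b c) (column i P) (column i P)
        = P *v (first_column (sgn (s * a * b * (a + b))) (sgn (c * (a + b))) $ i)" for i
      \<comment> \<open>Replacing the signs by the rescaled values leaves rational identities in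
        \<open>a\<close>, \<open>b\<close>, \<open>s\<close>, \<open>r\<close>,
        \<open>q\<close>.\<close>
      unfolding r(2)[symmetric] q(2)[symmetric]
      using exhaust_3[of i] s0
      by (auto simp: vec_eq_iff forall_3 sum_3 evol_mult_nth const_rows_def first_column_def P_def
          column_def matrix_vector_mult_def c field_simps power2_eq_square)
    show "evol_mult (const_rows a b c) (column i P) (column j P) = 0" if "i \<noteq> j" for i j
      using exhaust_3[of i] exhaust_3[of j] that s0
      by (auto simp: vec_eq_iff forall_3 sum_3 evol_mult_nth const_rows_def P_def
          column_def c field_simps)
  qed
  then show ?thesis
    unfolding s_def .
qed

text \<open>Here \<open>a + b = 0\<close>, so the vectors \<open>(b,-a,0)\<close> and
  \<open>(c,c,-p)\<close> become proportional and another basis is required.\<close>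

lemma evol_iso_const_rows_opposite:
  assumes "a \<noteq> 0" "c \<noteq> 0"
  shows "evol_iso (const_rows a (- a) c) (first_column 1 (- 1))"
proof -
  text \<open>On the \<open>Q\<close>-complement \<open>a (x\<^sub>1 - x\<^sub>2) + c x\<^sub>3 = 0\<close>, with \<open>x\<^sub>1 - x\<^sub>2 = 1\<close> and
    \<open>x\<^sub>1 + x\<^sub>2 = k - a/c\<close> one has \<open>cQ = a c k\<close>, and \<open>\<plusminus>k\<close> give orthogonal vectors.\<close>
  define k where "k = 1 / (a * c)"
  define P :: "real^3^3" where
    "P = vector [vector [1 / c, (k - a / c + 1) / 2, (- k - a / c + 1) / 2],
                 vector [1 / c, (k - a / c - 1) / 2, (- k - a / c - 1) / 2],
                 vector [1 / c, - a / c, - a / c]]"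
  have "det P = - k / c"
    using assms by (simp add: P_def det_3 field_simps)
  then have "invertible P"
    using assms by (simp add: k_def invertible_det_nz)
  then show ?thesis
  proof (rule evol_iso_change_of_basis)
    show "evol_mult (const_rows a (- a) c) (column i P) (column i P)
        = P *v (first_column 1 (- 1) $ i)" for i
      using exhaust_3[of i] assms
      by (auto simp: vec_eq_iff forall_3 sum_3 evol_mult_nth const_rows_def first_column_def P_def
          column_def matrix_vector_mult_def k_def field_simps power2_eq_square)
    show "evol_mult (const_rows a (- a) c) (column i P) (column j P) = 0" if "i \<noteq> j" for i j
      using exhaust_3[of i] exhaust_3[of j] that assms
      by (auto simp: vec_eq_iff forall_3 sum_3 evol_mult_nth const_rows_def P_def
          column_def k_def field_simps power2_eq_square)
  qed
qed

section \<open>Application to the matrices \<open>M1\<close>\<close>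

lemma M1_eq_const_rows:
  "M1 h g f s t = const_rows (h t / 2 * (1 / h s + f s)) (h t / 2 * (1 / h s - g s)) (h t / 2 * (g s - f s))"
  by (simp add: M1_def const_rows_def vec_eq_iff forall_3)

text \<open>The common factor \<open>h t / 2\<close> enters the two sign arguments only through its
  fourth power and its square, so the signs depend on the values at \<open>s\<close> alone.\<close>

lemma evol_iso_M1:
  assumes "h s \<noteq> 0" "h t \<noteq> 0" and p: "2 / h s + f s - g s \<noteq> 0"
  shows "evol_iso (M1 h g f s t)
    (first_column
      (sgn (2 / h s * (1 / h s + f s) * (1 / h s - g s) * (2 / h s + f s - g s)))
      (sgn ((g s - f s) * (2 / h s + f s - g s))))"
proof -
  define k where "k = h t / 2"
  define a where "a = 1 / h s + f s"
  define b where "b = 1 / h s - g s"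
  define c where "c = g s - f s"
  have k: "k \<noteq> 0"
    using assms by (simp add: k_def)
  have ab: "2 / h s + f s - g s = a + b" and abc: "2 / h s = a + b + c"
    by (auto simp: a_def b_def c_def)
  have "evol_iso (const_rows (k * a) (k * b) (k * c))
    (first_column (sgn ((k * a + k * b + k * c) * (k * a) * (k * b) * (k * a + k * b)))
      (sgn (k * c * (k * a + k * b))))"
  proof (rule evol_iso_const_rows)
    show "k * a + k * b \<noteq> 0"
      using k p by (simp add: ab flip: distrib_left)
    show "k * a + k * b + k * c \<noteq> 0"
      using k assms(1) by (simp flip: distrib_left abc)
  qed
  moreover have "sgn ((k * a + k * b + k * c) * (k * a) * (k * b) * (k * a + k * b))
      = sgn ((a + b + c) * a * b * (a + b))"
  proof -
    have eq: "(k * a + k * b + k * c) * (k * a) * (k * b) * (k * a + k * b)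
        = k ^ 4 * ((a + b + c) * a * b * (a + b))"
      by algebra
    show ?thesis
      unfolding eq by (rule sgn_mult_pos_left) (use k in simp)
  qed
  moreover have "sgn (k * c * (k * a + k * b)) = sgn (c * (a + b))"
  proof -
    have eq: "k * c * (k * a + k * b) = k\<^sup>2 * (c * (a + b))"
      by algebra
    show ?thesis
      unfolding eq by (rule sgn_mult_pos_left) (use k in simp)
  qed
  ultimately show ?thesis
    unfolding M1_eq_const_rows ab
    unfolding abc k_def[symmetric] a_def[symmetric] b_def[symmetric] c_def[symmetric]
    by simp
qed

theorem theorem1:
  fixes h g f :: "real \<Rightarrow> real" and s t :: real
  assumes h_nonzero: "\<forall>r\<ge>0. h r \<noteq> 0"
    and time: "0 \<le> s" "s \<le> t"
  shows "((g s = f s \<and> f s = 1 / h s) \<or>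
          (g s = f s \<and> f s = - (1 / h s)) \<or>
          (g s = - f s \<and> - f s = 1 / h s)
            \<longrightarrow> evol_iso (M1 h g f s t) E4)
    \<and> ((f s = - (1 / h s) \<and> (f s)\<^sup>2 > (g s)\<^sup>2) \<or>
       (g s = 1 / h s \<and> (g s)\<^sup>2 > (f s)\<^sup>2) \<or>
       (g s = f s \<and> 1 / (h s)\<^sup>2 > (f s)\<^sup>2)
         \<longrightarrow> evol_iso (M1 h g f s t) E5)
    \<and> ((f s = - (1 / h s) \<and> (f s)\<^sup>2 < (g s)\<^sup>2) \<or>
       (g s = 1 / h s \<and> (g s)\<^sup>2 < (f s)\<^sup>2) \<or>
       (g s = f s \<and> 1 / (h s)\<^sup>2 < (f s)\<^sup>2)
         \<longrightarrow> evol_iso (M1 h g f s t) E6)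
    \<and> ((1 / h s + f s) * (1 / h s - g s) * (g s - f s) \<noteq> 0 \<and>
       (g s - f s) * (2 / h s + f s - g s) > 0 \<and>
       2 / h s * (1 / h s + f s) * (1 / h s - g s) * (2 / h s + f s - g s) > 0
         \<longrightarrow> evol_iso (M1 h g f s t) E7)
    \<and> (((1 / h s + f s) * (1 / h s - g s) * (g s - f s) \<noteq> 0 \<and>
        (g s - f s) * (2 / h s + f s - g s) < 0 \<and>
        2 / h s * (1 / h s + f s) * (1 / h s - g s) * (2 / h s + f s - g s) > 0) \<or>
       ((1 / h s + f s) * (1 / h s - g s) * (g s - f s) \<noteq> 0 \<and>
        (g s - f s) * (2 / h s + f s - g s) > 0 \<and>
        2 / h s * (1 / h s + f s) * (1 / h s - g s) * (2 / h s + f s - g s) < 0) \<or>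
       ((1 / h s + f s) * (1 / h s - g s) * (g s - f s) \<noteq> 0 \<and>
        2 / h s + f s - g s = 0)
         \<longrightarrow> evol_iso (M1 h g f s t) E8)
    \<and> ((1 / h s + f s) * (1 / h s - g s) * (g s - f s) \<noteq> 0 \<and>
       (g s - f s) * (2 / h s + f s - g s) < 0 \<and>
       2 / h s * (1 / h s + f s) * (1 / h s - g s) * (2 / h s + f s - g s) < 0
         \<longrightarrow> evol_iso (M1 h g f s t) E9)"
proof -
  have hs: "h s \<noteq> 0" and ht: "h t \<noteq> 0"
    using h_nonzero time by auto
  define F x y where "F = 1 / h s" and "x = f s" and "y = g s"
  have F: "F \<noteq> 0" "1 / (h s)\<^sup>2 = F\<^sup>2" "2 / h s = 2 * F"
    using hs by (auto simp: F_def power_divide)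
  have E: "E4 = first_column 0 0" "E5 = first_column 0 1" "E6 = first_column 0 (- 1)"
    "E7 = first_column 1 1" "E8 = first_column 1 (- 1)" "E9 = first_column (- 1) (- 1)"
    by (simp_all add: E4_def E5_def E6_def E7_def E8_def E9_def first_column_def)
  let ?M = "M1 h g f s t"
  have M: "?M = const_rows (h t / 2 * (F + x)) (h t / 2 * (F - y)) (h t / 2 * (y - x))"
    by (simp add: M1_eq_const_rows F_def x_def y_def)
  have iso: "evol_iso ?M (first_column d e)"
    if "2 * F + x - y \<noteq> 0" "sgn (2 * F * (F + x) * (F - y) * (2 * F + x - y)) = d"
      "sgn ((y - x) * (2 * F + x - y)) = e" for d e
    using evol_iso_M1[where h=h and s=s and t=t and f=f and g=g, OF hs ht] that unfolding F(3) F_def x_def y_def by simp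
  have iso': "evol_iso ?M (first_column d e)"
    if "2 * F + x - y \<noteq> 0" "sgn (2 * F * (F + x) * (F - y) * (2 * F + x - y)) = e"
      "sgn ((y - x) * (2 * F + x - y)) = d" for d e
    by (rule evol_iso_trans[OF iso[OF that] evol_iso_first_column_swap])
  have c1: "evol_iso ?M E4" if "y = x \<and> x = F \<or> y = x \<and> x = - F \<or> y = - x \<and> - x = F"
    using that
  proof (elim disjE conjE)
    \<comment> \<open>Here \<open>2 * F + x - y = 0\<close> and the first two rows vanish, so
      \<open>iso\<close> does not apply directly and the rows are rotated first.\<close>
    assume "y = - x" "- x = F"
    then have x: "x = - F" and y: "y = F"
      by auto
    have "?M = const_rows 0 0 (h t * F)"
      unfolding M x y by simp
    also have "evol_iso \<dots> (const_rows 0 (h t * F) 0)"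
      by (rule evol_iso_const_rows_rotate)
    also have "evol_iso \<dots> (first_column 0 0)"
      using evol_iso_const_rows[of 0 "h t * F" 0] F(1) ht by simp
    finally show ?thesis
      unfolding E .
  \<comment> \<open>In the other two alternatives \<open>y = x\<close> and one of
    \<open>F + x\<close>, \<open>F - y\<close> is zero, so both signs vanish, while
    \<open>2 * F + x - y = 2 * F\<close>.\<close>
  qed (unfold E, rule iso; use F(1) in simp)+
  \<comment> \<open>The first two alternatives annihilate the first sign, and the second becomes
    that of a difference of squares. In the third, \<open>y = x\<close> annihilates the second sign
    instead, hence \<open>iso'\<close>.\<close>
  have c2: "evol_iso ?M E5"
    if "x = - F \<and> x\<^sup>2 > y\<^sup>2 \<or> y = F \<and> y\<^sup>2 > x\<^sup>2 \<or> y = x \<and> F\<^sup>2 > x\<^sup>2"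
    using that
  proof (elim disjE conjE)
    assume x: "x = - F" and less: "x\<^sup>2 > y\<^sup>2"
    have "(y - x) * (2 * F + x - y) = x\<^sup>2 - y\<^sup>2"
      unfolding x by algebra
    \<comment> \<open>Otherwise \<open>y = F = - x\<close>, contradicting the strict inequality
      between the squares.\<close>
    moreover have "2 * F + x - y \<noteq> 0"
      using x less by auto
    ultimately show ?thesis
      unfolding E using x less by (intro iso) auto
  next
    assume y: "y = F" and less: "y\<^sup>2 > x\<^sup>2"
    have "(y - x) * (2 * F + x - y) = y\<^sup>2 - x\<^sup>2"
      unfolding y by algebra
    moreover have "2 * F + x - y \<noteq> 0"
      using y less by (auto simp: add_eq_0_iff)
    ultimately show ?thesis
      unfolding E using y less by (intro iso) auto
  next
    assume y: "y = x" and less: "F\<^sup>2 > x\<^sup>2"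
    have "2 * F * (F + x) * (F - y) * (2 * F + x - y) = (2 * F)\<^sup>2 * (F\<^sup>2 - x\<^sup>2)"
      unfolding y by algebra
    moreover have "(2 * F)\<^sup>2 * (F\<^sup>2 - x\<^sup>2) > 0"
      using F(1) less by (intro mult_pos_pos) auto
    ultimately show ?thesis
      unfolding E using y F(1) by (intro iso') auto
  qed
  have c3: "evol_iso ?M E6"
    if "x = - F \<and> x\<^sup>2 < y\<^sup>2 \<or> y = F \<and> y\<^sup>2 < x\<^sup>2 \<or> y = x \<and> F\<^sup>2 < x\<^sup>2"
    using that
  proof (elim disjE conjE)
    assume x: "x = - F" and less: "x\<^sup>2 < y\<^sup>2"
    have "(y - x) * (2 * F + x - y) = x\<^sup>2 - y\<^sup>2"
      unfolding x by algebra
    moreover have "2 * F + x - y \<noteq> 0"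
      using x less by auto
    ultimately show ?thesis
      unfolding E using x less by (intro iso) auto
  next
    assume y: "y = F" and less: "y\<^sup>2 < x\<^sup>2"
    have "(y - x) * (2 * F + x - y) = y\<^sup>2 - x\<^sup>2"
      unfolding y by algebra
    moreover have "2 * F + x - y \<noteq> 0"
      using y less by (auto simp: add_eq_0_iff)
    ultimately show ?thesis
      unfolding E using y less by (intro iso) auto
  next
    assume y: "y = x" and less: "F\<^sup>2 < x\<^sup>2"
    have "2 * F * (F + x) * (F - y) * (2 * F + x - y) = (2 * F)\<^sup>2 * (F\<^sup>2 - x\<^sup>2)"
      unfolding y by algebra
    moreover have "(2 * F)\<^sup>2 * (F\<^sup>2 - x\<^sup>2) < 0"
      using F(1) less by (intro mult_pos_neg) auto
    ultimately show ?thesis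
      unfolding E using y F(1) by (intro iso') auto
  qed
  \<comment> \<open>A strict sign of either product already forces its factor
    \<open>2 * F + x - y\<close> to be nonzero, as \<open>iso\<close> requires.\<close>
  have c4: "evol_iso ?M E7" if "(y - x) * (2 * F + x - y) > 0"
    "2 * F * (F + x) * (F - y) * (2 * F + x - y) > 0"
    unfolding E by (rule iso) (use that in auto)
  have c5: "evol_iso ?M E8" if "(F + x) * (F - y) * (y - x) \<noteq> 0"
    "(y - x) * (2 * F + x - y) < 0 \<and> 2 * F * (F + x) * (F - y) * (2 * F + x - y) > 0 \<or>
     (y - x) * (2 * F + x - y) > 0 \<and> 2 * F * (F + x) * (F - y) * (2 * F + x - y) < 0 \<or>
     2 * F + x - y = 0"
    using that(2)
  proof (elim disjE conjE)
    \<comment> \<open>The first two rows are now opposite; the nonvanishing product makes the first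
      and third rows nonzero.\<close>
    assume "2 * F + x - y = 0"
    then have "F - y = - (F + x)"
      by simp
    then have "h t / 2 * (F - y) = - (h t / 2 * (F + x))"
      by (simp only: mult_minus_right)
    then show ?thesis
      using that(1) ht evol_iso_const_rows_opposite unfolding E M by auto
  next
    assume "(y - x) * (2 * F + x - y) < 0" "2 * F * (F + x) * (F - y) * (2 * F + x - y) > 0"
    then show ?thesis
      unfolding E by (intro iso) auto
  next
    assume "(y - x) * (2 * F + x - y) > 0" "2 * F * (F + x) * (F - y) * (2 * F + x - y) < 0"
    then show ?thesis
      unfolding E by (intro iso') auto
  qed
  have c6: "evol_iso ?M E9" if "(y - x) * (2 * F + x - y) < 0"
    "2 * F * (F + x) * (F - y) * (2 * F + x - y) < 0"
    unfolding E by (rule iso) (use that in auto)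
  show ?thesis
    unfolding F(2,3) F_def[symmetric] x_def[symmetric] y_def[symmetric]
    using c1 c2 c3 c4 c5 c6 by blast
qed

end
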